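(* Let $n\ge 1$, let $e\in D_{2n}$ be a diagonal projection of rank $n$, let $\theta\in[0,\pi/2]$, and put $d=\cos^2\theta\, e+\sin^2\theta\, e^{\perp}$. Then the set of projections $p\in M_{2n}(\mathbb{C})$ such that $E(p)=d$ is pathwise connected.
   Context: A projection is a matrix $p$ with $p=p^*=p^2$; $e^\perp=\mathrm{id}-e$. $D_{2n}\subset M_{2n}(\mathbb{C})$ is the algebra of diagonal matrices and $E\colon M_{2n}(\mathbb{C})\to D_{2n}$ is the linear map that replaces all off-diagonal entries by $0$ and keeps the diagonal entries. The set carries the topology inherited from $M_{2n}(\mathbb{C})$. *)

theory Defs
  imports "HOL-Analysis.Analysis"
begin

definition conj_transpose :: "complex^'n^'m \<Rightarrow> complex^'m^'n" where
  "conj_transpose A = (\<chi> i j. cnj (A $ j $ i))"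

definition projections :: "(complex^'m^'m) set" where
  "projections = {p. p = conj_transpose p \<and> p = p ** p}"

definition diagonal_matrices :: "(complex^'m^'m) set" where
  "diagonal_matrices = {A. \<forall>i j. i \<noteq> j \<longrightarrow> A $ i $ j = 0}"

definition diag_part :: "complex^'m^'m \<Rightarrow> complex^'m^'m" where
  "diag_part A = (\<chi> i j. if i = j then A $ i $ j else 0)"

(* The multiplication of matrices is **; the operation * on vectors and matrices is
   componentwise, so the identity matrix is mat 1, not 1. *)
definition perp :: "complex^'m^'m \<Rightarrow> complex^'m^'m" where
  "perp p = mat 1 - p"

end

theory Submission
  imports Defs
begin

text \<open>Diagonalising the compression of \<open>e\<close> to the range of such a \<open>p\<close> gives \<open>p = \<Sum>\<^sub>i v\<^sub>i v\<^sub>i\<^sup>*\<close> with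
  \<open>v\<^sub>i = \<surd>a\<^sub>i x\<^sub>i + \<surd>(1 - a\<^sub>i) y\<^sub>i\<close>, where \<open>x\<close> and \<open>y\<close> are orthonormal bases of the ranges of \<open>e\<close>
  and \<open>e\<^sup>\<bottom>\<close> (here equality of the two ranks is used). The diagonal of \<open>p\<close> is affine in the weights
  \<open>a\<^sub>i\<close>, and constant weights \<open>cos\<^sup>2 \<theta>\<close> also give the diagonal \<open>d\<close>, so the segment from \<open>a\<close> to
  the constant \<open>cos\<^sup>2 \<theta>\<close> yields a path of projections with diagonal \<open>d\<close>. The projections with
  constant weights form a continuous image of the unitaries that commute with \<open>e\<close>, and these are
  path connected.\<close>

section \<open>The Hermitian form and rank-one matrices\<close>

definition hdot :: "complex^'m \<Rightarrow> complex^'m \<Rightarrow> complex" where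
  "hdot x y = (\<Sum>i\<in>UNIV. cnj (x $ i) * y $ i)"

text \<open>The rank-one operator x y^*, which sends z to \<open>hdot y z *s x\<close>.\<close>

definition outer :: "complex^'m \<Rightarrow> complex^'m \<Rightarrow> complex^'m^'m" where
  "outer x y = (\<chi> i j. x $ i * cnj (y $ j))"

text \<open>The index set is arbitrary, so that one set of coordinates can index families in two
  different subspaces and inductions can run over finite sets.\<close>

definition orthonormal_on :: "'a set \<Rightarrow> ('a \<Rightarrow> complex^'m) \<Rightarrow> bool" where
  "orthonormal_on I v \<longleftrightarrow> (\<forall>i\<in>I. \<forall>j\<in>I. hdot (v i) (v j) = (if i = j then 1 else 0))"

lemma hdot_add_left: "hdot (x + y) z = hdot x z + hdot y z"
  by (simp add: hdot_def algebra_simps sum.distrib)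

lemma hdot_add_right: "hdot x (y + z) = hdot x y + hdot x z"
  by (simp add: hdot_def algebra_simps sum.distrib)

lemma hdot_diff_left: "hdot (x - y) z = hdot x z - hdot y z"
  by (simp add: hdot_def algebra_simps sum_subtractf)

lemma hdot_diff_right: "hdot x (y - z) = hdot x y - hdot x z"
  by (simp add: hdot_def algebra_simps sum_subtractf)

lemma hdot_scaleR_left: "hdot (r *\<^sub>R x) y = of_real r * hdot x y"
  by (simp add: hdot_def sum_distrib_left algebra_simps scaleR_conv_of_real[of r "_ :: complex"])

lemma hdot_scaleR_right: "hdot x (r *\<^sub>R y) = of_real r * hdot x y"
  by (simp add: hdot_def sum_distrib_left algebra_simps scaleR_conv_of_real[of r "_ :: complex"])

lemma hdot_smult_right: "hdot x (c *s y) = c * hdot x y"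
  by (simp add: hdot_def sum_distrib_left algebra_simps)

lemma hdot_zero [simp]: "hdot 0 x = 0"
  by (simp add: hdot_def)

lemma cnj_hdot: "cnj (hdot x y) = hdot y x"
  by (simp add: hdot_def algebra_simps)

lemma hdot_self: "hdot x x = of_real ((norm x)\<^sup>2)"
proof -
  have "(norm x)\<^sup>2 = (\<Sum>i\<in>UNIV. (cmod (x $ i))\<^sup>2)"
    by (simp add: norm_vec_def L2_set_def sum_nonneg)
  then show ?thesis
    by (simp add: hdot_def complex_norm_square mult.commute del: of_real_power)
qed

text \<open>Links the Hermitian form to the real inner product, in which the maximisation that
  produces eigenvectors is carried out.\<close>

lemma inner_eq_Re_hdot: "x \<bullet> y = Re (hdot x y)" for x y :: "complex^'m"
  by (simp add: inner_vec_def hdot_def inner_complex_def)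

lemma hdot_mult_right: "hdot x (A *v y) = hdot (conj_transpose A *v x) y"
proof -
  have "hdot x (A *v y) = (\<Sum>i\<in>UNIV. \<Sum>j\<in>UNIV. cnj (x $ i) * (A $ i $ j * y $ j))"
    by (simp add: hdot_def matrix_vector_mult_def sum_distrib_left)
  also have "\<dots> = (\<Sum>j\<in>UNIV. \<Sum>i\<in>UNIV. cnj (x $ i) * (A $ i $ j * y $ j))"
    by (rule sum.swap)
  also have "\<dots> = hdot (conj_transpose A *v x) y"
    by (simp add: hdot_def conj_transpose_def matrix_vector_mult_def sum_distrib_left mult_ac)
  finally show ?thesis .
qed

lemma conj_transpose_mult: "conj_transpose (A ** B) = conj_transpose B ** conj_transpose A"
  by (simp add: conj_transpose_def matrix_matrix_mult_def vec_eq_iff algebra_simps)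

lemma conj_transpose_diff: "conj_transpose (A - B) = conj_transpose A - conj_transpose B"
  by (simp add: conj_transpose_def vec_eq_iff)

lemma conj_transpose_sum: "conj_transpose (\<Sum>i\<in>I. A i) = (\<Sum>i\<in>I. conj_transpose (A i))"
  by (simp add: conj_transpose_def vec_eq_iff)

lemma conj_transpose_outer: "conj_transpose (outer x y) = outer y x"
  by (simp add: conj_transpose_def outer_def vec_eq_iff)

lemma mult_outer: "A ** outer x y = outer (A *v x) y"
  by (simp add: outer_def matrix_matrix_mult_def matrix_vector_mult_def vec_eq_iff
      sum_distrib_left mult_ac)

lemma outer_mult: "outer x y ** A = outer x (conj_transpose A *v y)"
  by (simp add: outer_def matrix_matrix_mult_def matrix_vector_mult_def conj_transpose_def
      vec_eq_iff sum_distrib_left mult_ac)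

lemma outer_mult_vec: "outer x y *v z = hdot y z *s x"
  by (simp add: outer_def matrix_vector_mult_def hdot_def vec_eq_iff sum_distrib_left mult_ac)

lemma outer_mult_outer: "outer x y ** outer z w = outer (hdot y z *s x) w"
  by (simp add: mult_outer outer_mult_vec)

lemma outer_zero [simp]: "outer 0 x = 0"
  by (simp add: outer_def vec_eq_iff)

lemma matrix_mult_add_left: "(A + B) ** C = A ** C + B ** (C :: 'a::semiring_1^'n^'m)"
  by (simp add: matrix_matrix_mult_def vec_eq_iff distrib_right sum.distrib)

lemma matrix_mult_diff_left: "(A - B) ** C = A ** C - B ** (C :: 'a::ring_1^'n^'m)"
  by (simp add: matrix_matrix_mult_def vec_eq_iff left_diff_distrib sum_subtractf)

lemma matrix_mult_diff_right: "A ** (B - C) = A ** B - A ** (C :: 'a::ring_1^'n^'m)"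
  by (simp add: matrix_matrix_mult_def vec_eq_iff right_diff_distrib sum_subtractf)

lemma matrix_mult_sum_left: "(\<Sum>i\<in>I. A i) ** B = (\<Sum>i\<in>I. A i ** (B :: 'a::semiring_1^'n^'m))"
  by (induction I rule: infinite_finite_induct) (simp_all add: matrix_mult_add_left)

lemma matrix_mult_sum_right: "B ** (\<Sum>i\<in>I. A i) = (\<Sum>i\<in>I. (B :: 'a::semiring_1^'n^'m) ** A i)"
  by (induction I rule: infinite_finite_induct) (simp_all add: matrix_add_ldistrib)

lemma trace_outer: "trace (outer x y) = hdot y x"
  by (simp add: trace_def outer_def hdot_def algebra_simps)

lemma trace_sum: "trace (\<Sum>i\<in>I. A i) = (\<Sum>i\<in>I. trace (A i))"
  by (simp add: trace_def sum.swap[of _ UNIV])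

section \<open>Projections, with the trace in the role of the rank\<close>

lemma projectionsD:
  assumes "p \<in> projections"
  shows "conj_transpose p = p" "p ** p = p"
  using assms by (simp_all add: projections_def)

text \<open>Since p equals p times its adjoint, its trace is the sum of the squared moduli of all
  entries.\<close>

lemma projection_trace_0:
  assumes p: "p \<in> projections" and "trace p = 0"
  shows "p = 0"
proof -
  have "p $ i $ i = of_real (\<Sum>j\<in>UNIV. (cmod (p $ i $ j))\<^sup>2)" for i
  proof -
    have "p $ i $ i = (p ** conj_transpose p) $ i $ i"
      using projectionsD[OF p] by simp
    then show ?thesis
      by (simp add: conj_transpose_def matrix_matrix_mult_def complex_norm_square del: of_real_power)
  qed
  then have "trace p = of_real (\<Sum>i\<in>UNIV. \<Sum>j\<in>UNIV. (cmod (p $ i $ j))\<^sup>2)"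
    by (simp add: trace_def)
  with assms(2) have "(\<Sum>i\<in>UNIV. \<Sum>j\<in>UNIV. (cmod (p $ i $ j))\<^sup>2) = 0"
    by (metis of_real_eq_0_iff)
  then show ?thesis
    by (simp add: sum_nonneg_eq_0_iff sum_nonneg vec_eq_iff)
qed

lemma sum_outer_projection:
  assumes "finite I" "orthonormal_on I v"
  shows "(\<Sum>i\<in>I. outer (v i) (v i)) \<in> projections"
proof -
  have "outer (v i) (v i) ** (\<Sum>j\<in>I. outer (v j) (v j)) = outer (v i) (v i)" if "i \<in> I" for i
  proof -
    have "outer (v i) (v i) ** (\<Sum>j\<in>I. outer (v j) (v j))
        = (\<Sum>j\<in>I. if j = i then outer (v i) (v i) else 0)"
      unfolding matrix_mult_sum_right
      using assms that by (intro sum.cong) (auto simp: outer_mult_outer orthonormal_on_def)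
    then show ?thesis using that assms by simp
  qed
  then show ?thesis
    by (simp add: projections_def conj_transpose_sum conj_transpose_outer matrix_mult_sum_left)
qed

text \<open>Taking adjoints in \<open>Q ** R = R\<close> gives \<open>R ** Q = R\<close>, and then
  the square of the difference expands to the difference.\<close>

lemma diff_projection:
  assumes Q: "Q \<in> projections" and R: "R \<in> projections" and QR: "Q ** R = R"
  shows "Q - R \<in> projections"
proof -
  have "R ** Q = R"
    using QR by (metis Q R conj_transpose_mult projectionsD(1))
  then have "(Q - R) ** (Q - R) = Q - R"
    using QR by (simp add: matrix_mult_diff_right matrix_mult_diff_left projectionsD[OF Q] projectionsD[OF R])
  then show ?thesis
    by (simp add: projections_def conj_transpose_diff projectionsD[OF Q] projectionsD[OF R])
qed

lemma mult_sum_outer: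
  assumes "\<And>i. i \<in> I \<Longrightarrow> Q *v v i = v i"
  shows "Q ** (\<Sum>i\<in>I. outer (v i) (v i)) = (\<Sum>i\<in>I. outer (v i) (v i))"
  using assms by (simp add: matrix_mult_sum_right mult_outer)

lemma sum_outer_mult_vec:
  assumes "finite I" "orthonormal_on I v" "i \<in> I"
  shows "(\<Sum>j\<in>I. outer (v j) (v j)) *v v i = v i"
proof -
  have "(\<Sum>j\<in>I. outer (v j) (v j)) *v v i = (\<Sum>j\<in>I. outer (v j) (v j) *v v i)"
    by (induction I rule: infinite_finite_induct) (simp_all add: matrix_vector_mult_add_rdistrib)
  also have "\<dots> = (\<Sum>j\<in>I. if j = i then v i else 0)"
    using assms by (intro sum.cong) (auto simp: outer_mult_vec orthonormal_on_def)
  finally show ?thesis using assms by simp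
qed

section \<open>Orthonormal bases that diagonalise a compression\<close>

lemma nonneg_quadratic_linear_coeff_0:
  fixes b c :: real
  assumes "\<And>t. 0 \<le> 2 * t * b + t\<^sup>2 * c"
  shows "b = 0"
proof -
  \<comment> \<open>The linear terms at t = 1 and t = -1 cancel when the two inequalities are
    added.\<close>
  have c: "c \<ge> 0" using assms[of 1] assms[of "-1"] by simp
  \<comment> \<open>The minimiser would be -b/c; the denominator c + 1 also covers c = 0 and still
    makes the value negative unless b = 0.\<close>
  have "2 * (- b / (c + 1)) * b + (- b / (c + 1))\<^sup>2 * c = - (b\<^sup>2 * (c + 2) / (c + 1)\<^sup>2)"
    using c by (simp add: divide_simps power2_eq_square) algebra
  then have "b\<^sup>2 * (c + 2) / (c + 1)\<^sup>2 \<le> 0"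
    using assms[of "- b / (c + 1)"] by linarith
  then show ?thesis using c
    by (simp add: divide_le_0_iff mult_le_0_iff)
qed

text \<open>A maximiser of \<open>v \<bullet> (A v)\<close> over the unit sphere of the range of \<open>Q\<close>
  is an eigenvector of the compression of \<open>A\<close>.\<close>

lemma compression_eigenvector:
  fixes Q A :: "complex^'m^'m"
  assumes Q: "Q \<in> projections" and "Q \<noteq> 0" and A: "conj_transpose A = A"
  obtains v and l :: real where "norm v = 1" "Q *v v = v" "Q *v (A *v v) = l *\<^sub>R v"
proof -
  define S where "S = {v :: complex^'m. norm v = 1 \<and> Q *v v = v}"
  have lin: "linear (\<lambda>x. B *v x)" for B :: "complex^'m^'m"
    by (rule linearI) (simp_all add: matrix_vector_mult_def vec_eq_iff distrib_left sum.distrib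
        scaleR_sum_right)
  have scaleR: "B *v (r *\<^sub>R x) = r *\<^sub>R (B *v x)" for B :: "complex^'m^'m" and r x
    using lin by (simp add: linear_scale)
  have cont: "continuous_on T (\<lambda>x. B *v x)" for B :: "complex^'m^'m" and T
    using lin by (simp add: linear_continuous_on linear_conv_bounded_linear)
  have "S = sphere 0 1 \<inter> {v. Q *v v = v}"
    by (auto simp: S_def)
  then have "compact S"
    using cont by (simp add: compact_Int_closed closed_Collect_eq)
  moreover have "S \<noteq> {}"
  proof -
    obtain w where w: "Q *v w \<noteq> 0"
      using \<open>Q \<noteq> 0\<close> by (metis matrix_eq matrix_vector_mult_0)
    have "Q *v (Q *v w) = Q *v w"
      by (simp add: matrix_vector_mul_assoc projectionsD[OF Q])
    then have "(1 / norm (Q *v w)) *\<^sub>R (Q *v w) \<in> S"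
      using w by (simp add: S_def scaleR)
    then show ?thesis by blast
  qed
  moreover have "continuous_on S (\<lambda>u. u \<bullet> (A *v u))"
    by (intro continuous_on_inner continuous_on_id cont)
  ultimately obtain v where v: "v \<in> S" "\<And>u. u \<in> S \<Longrightarrow> u \<bullet> (A *v u) \<le> v \<bullet> (A *v v)"
    using continuous_attains_sup[of S "\<lambda>u. u \<bullet> (A *v u)"] by blast
  define l where "l = v \<bullet> (A *v v)"
  \<comment> \<open>By homogeneity, maximality on the unit sphere becomes a bound on the whole range
    of \<open>Q\<close>, so the variations \<open>v + t *\<^sub>R u\<close> need not be
    normalised.\<close>
  have le: "u \<bullet> (A *v u) \<le> l * (u \<bullet> u)" if "Q *v u = u" for u
  proof (cases "u = 0")
    case False
    then have "(1 / norm u) *\<^sub>R u \<in> S" using that by (simp add: S_def scaleR)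
    from v(2)[OF this] False show ?thesis
      by (simp add: scaleR l_def divide_simps power2_norm_eq_inner flip: power2_eq_square)
  qed simp
  have symm: "x \<bullet> (A *v y) = y \<bullet> (A *v x)" for x y
    by (metis A hdot_mult_right inner_commute inner_eq_Re_hdot)
  \<comment> \<open>The form l |w|^2 - w \<bullet> A w is nonnegative on the range of
    \<open>Q\<close> and vanishes at \<open>v\<close>, so its first variation at \<open>v\<close> in
    any direction of the range is zero.\<close>
  have crit: "u \<bullet> (l *\<^sub>R v - A *v v) = 0" if u: "Q *v u = u" for u
  proof (rule nonneg_quadratic_linear_coeff_0)
    fix t :: real
    have "Q *v (v + t *\<^sub>R u) = v + t *\<^sub>R u"
      using u v(1) by (simp add: S_def matrix_vector_right_distrib scaleR)
    from le[OF this] have "0 \<le> l * ((v + t *\<^sub>R u) \<bullet> (v + t *\<^sub>R u)) - (v + t *\<^sub>R u) \<bullet> (A *v (v + t *\<^sub>R u))"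
      by simp
    also have "\<dots> = 2 * t * (u \<bullet> (l *\<^sub>R v - A *v v)) + t\<^sup>2 * (l * (u \<bullet> u) - u \<bullet> (A *v u))
        + (l * (v \<bullet> v) - l)"
      by (simp add: matrix_vector_right_distrib scaleR inner_add_left inner_add_right inner_diff_right
          symm[of v u] inner_commute[of v u] flip: l_def) (simp add: algebra_simps power2_eq_square)
    also have "l * (v \<bullet> v) - l = 0"
      using v(1) by (simp add: S_def norm_eq_1)
    finally show "0 \<le> 2 * t * (u \<bullet> (l *\<^sub>R v - A *v v)) + t\<^sup>2 * (l * (u \<bullet> u) - u \<bullet> (A *v u))"
      by simp
  qed
  define r where "r = l *\<^sub>R v - A *v v"
  have QQ: "Q *v (Q *v r) = Q *v r"
    by (simp add: matrix_vector_mul_assoc projectionsD[OF Q])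
  \<comment> \<open>Criticality in the direction \<open>Q *v r\<close> itself shows that
    \<open>Q *v r\<close> has norm zero, so real orthogonality suffices here.\<close>
  have "(Q *v r) \<bullet> (Q *v r) = (Q *v (Q *v r)) \<bullet> r"
    by (metis Q hdot_mult_right inner_eq_Re_hdot projectionsD(1))
  also have "\<dots> = 0" using crit[OF QQ] QQ by (simp add: r_def)
  finally have "Q *v r = 0" by simp
  then have "Q *v (A *v v) = l *\<^sub>R v"
    using v(1) by (simp add: r_def S_def matrix_vector_mult_diff_distrib scaleR)
  with v(1) show ?thesis using that by (auto simp: S_def)
qed

text \<open>Induction on the index set: split off a unit eigenvector \<open>w\<close> of the
  compression of \<open>A\<close> to the range of \<open>Q\<close> and continue with
  \<open>Q - outer w w\<close>, whose trace is smaller by one. For \<open>A = 0\<close> this merely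
  supplies an orthonormal basis of the range.\<close>

lemma projection_diagonalizing_basis:
  assumes "finite I" "Q \<in> projections" "trace Q = of_nat (card I)" "conj_transpose A = A"
  obtains v where "orthonormal_on I v" "Q = (\<Sum>i\<in>I. outer (v i) (v i))"
    "\<And>i j. i \<in> I \<Longrightarrow> j \<in> I \<Longrightarrow> i \<noteq> j \<Longrightarrow> hdot (v i) (A *v v j) = 0"
proof -
  have "\<exists>v. orthonormal_on I v \<and> Q = (\<Sum>i\<in>I. outer (v i) (v i)) \<and>
    (\<forall>i\<in>I. \<forall>j\<in>I. i \<noteq> j \<longrightarrow> hdot (v i) (A *v v j) = 0)"
    using assms(1-3)
  proof (induction I arbitrary: Q rule: finite_induct)
    case empty
    then show ?case using projection_trace_0[of Q] by (simp add: orthonormal_on_def)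
  next
    case (insert k I)
    have "trace Q = of_nat (Suc (card I))"
      using insert.hyps insert.prems by simp
    then have "trace Q \<noteq> 0" by (simp only: of_nat_eq_0_iff)
    then have "Q \<noteq> 0" by (auto simp: trace_def)
    then obtain w l where w: "norm w = 1" "Q *v w = w" "Q *v (A *v w) = (l::real) *\<^sub>R w"
      using compression_eigenvector[OF insert.prems(1) _ assms(4)] by metis
    have ww: "hdot w w = 1" using w(1) by (simp add: hdot_self)
    have "outer w w \<in> projections"
      using sum_outer_projection[of "{k}" "\<lambda>_. w"] ww by (simp add: orthonormal_on_def)
    then have "Q - outer w w \<in> projections"
      using insert.prems(1) w(2) by (intro diff_projection) (simp_all add: mult_outer)
    moreover have "trace (Q - outer w w) = of_nat (card I)"
      using insert.hyps insert.prems ww by (simp add: trace_sub trace_outer)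
    ultimately obtain v where v: "orthonormal_on I v" "Q - outer w w = (\<Sum>i\<in>I. outer (v i) (v i))"
      "\<forall>i\<in>I. \<forall>j\<in>I. i \<noteq> j \<longrightarrow> hdot (v i) (A *v v j) = 0"
      using insert.IH[of "Q - outer w w"] by auto
    have Qv: "Q *v v i = v i" and wv: "hdot w (v i) = 0" if "i \<in> I" for i
    proof -
      have *: "(Q - outer w w) *v v i = v i"
        using sum_outer_mult_vec[OF insert.hyps(1) v(1) that] v(2) by simp
      \<comment> \<open>\<open>Q\<close> is self-adjoint and fixes \<open>w\<close>, so subtracting
        \<open>outer w w\<close> removes exactly the component along \<open>w\<close>.\<close>
      have Qw: "hdot w (Q *v x) = hdot w x" for x
        by (metis hdot_mult_right insert.prems(1) projectionsD(1) w(2))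
      have "hdot w (v i) = hdot w ((Q - outer w w) *v v i)" by (simp add: *)
      also have "\<dots> = 0"
        by (simp add: matrix_vector_mult_diff_rdistrib hdot_diff_right Qw
            outer_mult_vec hdot_smult_right ww)
      finally show "hdot w (v i) = 0" .
      then show "Q *v v i = v i"
        using * by (simp add: matrix_vector_mult_diff_rdistrib outer_mult_vec)
    qed
    have vw: "hdot (v i) w = 0" if "i \<in> I" for i
      using wv[OF that] by (metis cnj_hdot complex_cnj_zero)
    \<comment> \<open>As \<open>v i\<close> lies in the range of \<open>Q\<close>, the vector
      \<open>A *v w\<close> may be replaced by its compression, a multiple of \<open>w\<close>,
      which is orthogonal to \<open>v i\<close>.\<close>
    have vAw: "hdot (v i) (A *v w) = 0" if "i \<in> I" for i
    proof -
      have "hdot (v i) (A *v w) = hdot (v i) (Q *v (A *v w))"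
        by (simp add: hdot_mult_right[of _ Q] projectionsD[OF insert.prems(1)] Qv[OF that])
      then show ?thesis by (simp add: w(3) hdot_scaleR_right vw[OF that])
    qed
    then have wAv: "hdot w (A *v v i) = 0" if "i \<in> I" for i
      using that by (metis assms(4) cnj_hdot complex_cnj_zero hdot_mult_right)
    have "Q = outer w w + (\<Sum>i\<in>I. outer (v i) (v i))" using v(2) by (simp add: algebra_simps)
    also have "(\<Sum>i\<in>I. outer (v i) (v i)) = (\<Sum>i\<in>I. outer ((v(k := w)) i) ((v(k := w)) i))"
      using insert.hyps by (intro sum.cong) auto
    finally have "Q = (\<Sum>i\<in>insert k I. outer ((v(k := w)) i) ((v(k := w)) i))"
      using insert.hyps by simp
    moreover have "orthonormal_on (insert k I) (v(k := w))"
      using v(1) wv vw ww insert.hyps by (auto simp: orthonormal_on_def)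
    moreover have "\<forall>i\<in>insert k I. \<forall>j\<in>insert k I. i \<noteq> j \<longrightarrow>
        hdot ((v(k := w)) i) (A *v (v(k := w)) j) = 0"
      using v(3) vAw wAv insert.hyps by auto
    ultimately show ?case by blast
  qed
  then show ?thesis using that by blast
qed

text \<open>The nonzero \<open>f i\<close> are normalised, and the indices with
  \<open>f i = 0\<close> receive an orthonormal basis of what remains of the range of
  \<open>E\<close>. The trace condition makes the numbers of vectors match, and at the added indices
  the scaling identity reads 0 = 0.\<close>

lemma extend_orthogonal_to_basis:
  assumes "finite I" "E \<in> projections" "trace E = of_nat (card I)"
    and "\<And>i. i \<in> I \<Longrightarrow> E *v f i = f i"
    and "\<And>i j. i \<in> I \<Longrightarrow> j \<in> I \<Longrightarrow> i \<noteq> j \<Longrightarrow> hdot (f i) (f j) = 0"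
  obtains x where "orthonormal_on I x" "E = (\<Sum>i\<in>I. outer (x i) (x i))"
    "\<And>i. i \<in> I \<Longrightarrow> f i = norm (f i) *\<^sub>R x i"
proof -
  define K where "K = {i \<in> I. f i \<noteq> 0}"
  define g where "g i = (1 / norm (f i)) *\<^sub>R f i" for i
  have fin: "finite K" "finite (I - K)" using assms(1) by (auto simp: K_def)
  have g: "orthonormal_on K g"
    using assms(5) by (auto simp: orthonormal_on_def K_def g_def hdot_scaleR_left hdot_scaleR_right
        hdot_self power2_eq_square)
  have Eg: "E *v g i = g i" if "i \<in> K" for i
    using assms(4)[of i] that
    by (simp add: K_def g_def matrix_vector_mult_def vec_eq_iff flip: scaleR_sum_right)
  define R where "R = (\<Sum>i\<in>K. outer (g i) (g i))"
  have R: "R \<in> projections" "E ** R = R"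
    using sum_outer_projection[OF fin(1) g] mult_sum_outer[of K E g] Eg by (auto simp: R_def)
  have trR: "trace R = of_nat (card K)"
    using g by (simp add: R_def trace_sum trace_outer orthonormal_on_def)
  have "card I = card K + card (I - K)"
    using assms(1) by (metis (no_types, lifting) K_def card_Diff_subset card_mono fin(1)
        le_add_diff_inverse mem_Collect_eq subsetI)
  then have "trace (E - R) = of_nat (card (I - K))"
    using assms(3) trR by (simp add: trace_sub)
  \<comment> \<open>The diagonalising basis for the zero matrix, used only as an orthonormal basis
    of the range of \<open>E - R\<close>.\<close>
  then obtain h where h: "orthonormal_on (I - K) h" "E - R = (\<Sum>i\<in>I-K. outer (h i) (h i))"
    using projection_diagonalizing_basis[OF fin(2) diff_projection[OF assms(2) R], of 0]
    by (metis conj_transpose_diff diff_self)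
  have gh: "hdot (g i) (h j) = 0" if "i \<in> K" "j \<in> I - K" for i j
  proof -
    have "h j = (E - R) *v h j" using sum_outer_mult_vec[OF fin(2) h(1) that(2)] h(2) by simp
    then have "hdot (g i) (h j) = hdot (conj_transpose (E - R) *v g i) (h j)"
      by (metis hdot_mult_right)
    \<comment> \<open>Both \<open>E\<close> and \<open>R\<close> fix \<open>g i\<close>, so it is
      orthogonal to the range of \<open>E - R\<close>.\<close>
    also have "conj_transpose (E - R) *v g i = 0"
      using Eg[OF that(1)] sum_outer_mult_vec[OF fin(1) g that(1)]
      by (simp add: conj_transpose_diff projectionsD[OF R(1)] projectionsD[OF assms(2)]
          matrix_vector_mult_diff_rdistrib flip: R_def)
    finally show ?thesis by simp
  qed
  then have hg: "hdot (h j) (g i) = 0" if "i \<in> K" "j \<in> I - K" for i j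
    using that by (metis cnj_hdot complex_cnj_zero)
  define x where "x i = (if i \<in> K then g i else h i)" for i
  have "E = R + (\<Sum>i\<in>I-K. outer (h i) (h i))" using h(2) by (simp add: algebra_simps)
  also have "\<dots> = (\<Sum>i\<in>K. outer (x i) (x i)) + (\<Sum>i\<in>I-K. outer (x i) (x i))"
    by (simp add: R_def x_def)
  also have "\<dots> = (\<Sum>i\<in>I. outer (x i) (x i))"
    using assms(1) by (subst add.commute, subst sum.subset_diff[of K I]) (auto simp: K_def)
  finally have "E = (\<Sum>i\<in>I. outer (x i) (x i))" .
  moreover have "orthonormal_on I x"
    using g h(1) gh hg by (auto simp: orthonormal_on_def x_def)
  moreover have "f i = norm (f i) *\<^sub>R x i" if "i \<in> I" for i
    using that by (auto simp: x_def K_def g_def)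
  ultimately show ?thesis using that by blast
qed

section \<open>Coordinate projections\<close>

definition coord_proj :: "'m set \<Rightarrow> complex^'m^'m" where
  "coord_proj I = (\<chi> i j. if i = j \<and> i \<in> I then 1 else 0)"

lemma coord_proj_mult_vec: "(coord_proj I *v x) $ k = (if k \<in> I then x $ k else 0)"
proof -
  have "(coord_proj I *v x) $ k = (\<Sum>j\<in>UNIV. if j = k then (if k \<in> I then x $ k else 0) else 0)"
    by (auto simp: coord_proj_def matrix_vector_mult_def intro!: sum.cong
        simp: if_distrib[of "\<lambda>c. c * _"] cong: if_cong)
  then show ?thesis by simp
qed

lemma conj_transpose_coord_proj [simp]: "conj_transpose (coord_proj I) = coord_proj I"
  by (auto simp: conj_transpose_def coord_proj_def vec_eq_iff)

lemma coord_proj_idem: "coord_proj I *v (coord_proj I *v x) = coord_proj I *v x"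
  by (simp add: vec_eq_iff coord_proj_mult_vec)

lemma coord_proj_projection: "coord_proj I \<in> projections"
proof -
  have "coord_proj I ** coord_proj I = coord_proj I"
    by (subst matrix_eq) (simp add: coord_proj_idem flip: matrix_vector_mul_assoc)
  then show ?thesis by (simp add: projections_def)
qed

lemma trace_coord_proj: "trace (coord_proj I) = of_nat (card I)"
proof -
  have "trace (coord_proj I) = (\<Sum>i\<in>UNIV. if i \<in> I then 1 else 0)"
    by (simp add: trace_def coord_proj_def)
  then show ?thesis by (simp add: sum.If_cases)
qed

lemma coord_proj_add_compl: "coord_proj I + coord_proj (- I) = mat 1"
  by (auto simp: coord_proj_def mat_def vec_eq_iff)

text \<open>The nonzero rows are the standard basis vectors indexed by \<open>I\<close>, so the row
  space is a coordinate subspace. This turns the rank hypothesis into a cardinality.\<close>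

lemma rank_coord_proj: "rank (coord_proj I) = card I"
proof -
  have row: "row i (coord_proj I) = (if i \<in> I then axis i 1 else 0)" for i
    by (auto simp: row_def coord_proj_def axis_def vec_eq_iff)
  have "vec.span (rows (coord_proj I)) = {x. \<forall>i. i \<notin> I \<longrightarrow> x $ i = 0}" (is "_ = ?T")
  proof
    have "vec.subspace ?T" by (simp add: vec.subspace_def)
    moreover have "rows (coord_proj I) \<subseteq> ?T"
      by (auto simp: rows_def row axis_def split: if_splits)
    ultimately show "vec.span (rows (coord_proj I)) \<subseteq> ?T" by (rule vec.span_minimal[rotated])
  next
    show "?T \<subseteq> vec.span (rows (coord_proj I))"
    proof
      fix x assume "x \<in> ?T"
      then have "x = (\<Sum>i\<in>UNIV. x $ i *s row i (coord_proj I))"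
        by (subst (1) basis_expansion[symmetric], intro sum.cong) (auto simp: row)
      also have "\<dots> \<in> vec.span (rows (coord_proj I))"
        by (intro vec.span_sum vec.span_scale vec.span_base) (auto simp: rows_def)
      finally show "x \<in> vec.span (rows (coord_proj I))" .
    qed
  qed
  then show ?thesis
    using dim_substandard_cart[where 'a=complex, of I] vec.dim_span[of "rows (coord_proj I)"]
    unfolding row_rank_def_gen by presburger
qed

text \<open>Each diagonal entry of an idempotent diagonal matrix equals its own square, hence is 0
  or 1.\<close>

lemma diagonal_projection_eq_coord_proj:
  assumes "e \<in> diagonal_matrices" "e \<in> projections"
  shows "e = coord_proj {i. e $ i $ i = 1}"
proof -
  have off: "e $ i $ j = 0" if "i \<noteq> j" for i j
    using assms(1) that by (simp add: diagonal_matrices_def)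
  have "e $ i $ i = e $ i $ i * e $ i $ i" for i
  proof -
    have "e $ i $ i = (\<Sum>k\<in>UNIV. e $ i $ k * e $ k $ i)"
      using arg_cong[OF projectionsD(2)[OF assms(2)], of "\<lambda>A. A $ i $ i"]
      by (simp add: matrix_matrix_mult_def)
    also have "\<dots> = (\<Sum>k\<in>UNIV. if k = i then e $ i $ i * e $ i $ i else 0)"
      by (intro sum.cong) (auto simp: off)
    finally show ?thesis by simp
  qed
  then have "e $ i $ j = (if i = j \<and> e $ i $ i = 1 then 1 else 0)" for i j
    using off
    by (metis mult_cancel_right1)
  then show ?thesis
    unfolding coord_proj_def vec_eq_iff vec_lambda_beta mem_Collect_eq by blast
qed

section \<open>Projections with a two-level diagonal in terms of frames and weights\<close>

definition two_level_projections :: "'m set \<Rightarrow> real \<Rightarrow> (complex^'m^'m) set" where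
  "two_level_projections I c =
     {p \<in> projections. \<forall>k. p $ k $ k = of_real (if k \<in> I then c else 1 - c)}"

text \<open>Orthonormal bases of the two complementary coordinate subspaces, completeness being
  expressed by the sums of outer products. Both are indexed by \<open>I\<close>, so that
  \<open>x i\<close> can be paired with \<open>y i\<close>; this encodes the equality of the two
  dimensions.\<close>

definition adapted_frames :: "'m set \<Rightarrow> ('m \<Rightarrow> complex^'m) \<Rightarrow> ('m \<Rightarrow> complex^'m) \<Rightarrow> bool" where
  "adapted_frames I x y \<longleftrightarrow>
     orthonormal_on I x \<and> (\<Sum>i\<in>I. outer (x i) (x i)) = coord_proj I \<and>
     orthonormal_on I y \<and> (\<Sum>i\<in>I. outer (y i) (y i)) = coord_proj (- I)"

text \<open>For adapted frames and weights in [0,1], the \<open>a i\<close> are the squared cosines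
  of the principal angles between the range and the coordinate subspace of \<open>I\<close>.\<close>

definition mixed_projection ::
    "'m set \<Rightarrow> ('m \<Rightarrow> complex^'m) \<Rightarrow> ('m \<Rightarrow> complex^'m) \<Rightarrow> ('m \<Rightarrow> real) \<Rightarrow> complex^'m^'m" where
  "mixed_projection I x y a =
     (\<Sum>i\<in>I. outer (sqrt (a i) *\<^sub>R x i + sqrt (1 - a i) *\<^sub>R y i)
                   (sqrt (a i) *\<^sub>R x i + sqrt (1 - a i) *\<^sub>R y i))"

lemma adapted_frames_support:
  assumes "adapted_frames I x y" "i \<in> I"
  shows "k \<notin> I \<Longrightarrow> x i $ k = 0" "k \<in> I \<Longrightarrow> y i $ k = 0"
proof -
  have "coord_proj I *v x i = x i" "coord_proj (- I) *v y i = y i"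
    using assms sum_outer_mult_vec[of I x i] sum_outer_mult_vec[of I y i]
    by (auto simp: adapted_frames_def)
  then show "k \<notin> I \<Longrightarrow> x i $ k = 0" "k \<in> I \<Longrightarrow> y i $ k = 0"
    by (metis coord_proj_mult_vec, metis ComplD coord_proj_mult_vec)
qed

lemma adapted_frames_hdot:
  assumes "adapted_frames I x y" "i \<in> I" "j \<in> I"
  shows "hdot (x i) (y j) = 0" "hdot (y j) (x i) = 0"
proof -
  have "x i $ k = 0 \<or> y j $ k = 0" for k
    using adapted_frames_support assms by metis
  then have "cnj (x i $ k) * y j $ k = 0" for k
    by (metis complex_cnj_zero mult_zero_left mult_zero_right)
  then show "hdot (x i) (y j) = 0" unfolding hdot_def by (intro sum.neutral ballI)
  then show "hdot (y j) (x i) = 0" by (metis cnj_hdot complex_cnj_zero)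
qed

text \<open>Parseval's identity, read off from a diagonal entry of the completeness
  relation.\<close>

lemma sum_outer_diag:
  assumes "(\<Sum>i\<in>I. outer (x i) (x i)) = coord_proj J" "k \<in> J"
  shows "(\<Sum>i\<in>I. (cmod (x i $ k))\<^sup>2) = 1"
proof -
  have "complex_of_real (\<Sum>i\<in>I. (cmod (x i $ k))\<^sup>2) = (\<Sum>i\<in>I. outer (x i) (x i)) $ k $ k"
    by (simp add: outer_def complex_norm_square del: of_real_power)
  also have "\<dots> = 1" using assms by (simp add: coord_proj_def)
  finally show ?thesis by (metis of_real_eq_1_iff)
qed

lemma mixed_projection_projection:
  assumes fr: "adapted_frames I x y" and a: "\<And>i. i \<in> I \<Longrightarrow> 0 \<le> a i \<and> a i \<le> 1"
  shows "mixed_projection I x y a \<in> projections"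
  unfolding mixed_projection_def
proof (rule sum_outer_projection)
  have "complex_of_real (sqrt (a i)) * (complex_of_real (sqrt (a i)) * 1) +
      complex_of_real (sqrt (1 - a i)) * (complex_of_real (sqrt (1 - a i)) * 1) = 1"
    if "i \<in> I" for i
    using a[OF that] by (simp flip: of_real_mult of_real_add)
  then show "orthonormal_on I (\<lambda>i. sqrt (a i) *\<^sub>R x i + sqrt (1 - a i) *\<^sub>R y i)"
    using fr unfolding orthonormal_on_def
    by (auto simp: hdot_add_left hdot_add_right hdot_scaleR_left hdot_scaleR_right
        adapted_frames_hdot[OF fr])
       (auto simp: adapted_frames_def orthonormal_on_def)
qed simp

text \<open>At each coordinate either all \<open>x i\<close> or all \<open>y i\<close> vanish, so
  the cross terms with the product of the two square roots never reach the diagonal. What is left is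
  affine in the weights.\<close>

lemma mixed_projection_diag:
  assumes fr: "adapted_frames I x y" and a: "\<And>i. i \<in> I \<Longrightarrow> 0 \<le> a i \<and> a i \<le> 1"
  shows "mixed_projection I x y a $ k $ k = of_real
    (if k \<in> I then \<Sum>i\<in>I. a i * (cmod (x i $ k))\<^sup>2 else \<Sum>i\<in>I. (1 - a i) * (cmod (y i $ k))\<^sup>2)"
proof -
  have sq: "of_real (sqrt r) * u * (of_real (sqrt r) * cnj u) = of_real (r * (cmod u)\<^sup>2)"
    if "0 \<le> r" for r u
  proof -
    have "of_real (sqrt r) * u * (of_real (sqrt r) * cnj u) = of_real (sqrt r * sqrt r) * (u * cnj u)"
      by (simp only: of_real_mult mult_ac)
    then show ?thesis
      using that by (simp add: complex_norm_square del: of_real_power)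
  qed
  have "(outer (sqrt (a i) *\<^sub>R x i + sqrt (1 - a i) *\<^sub>R y i)
                (sqrt (a i) *\<^sub>R x i + sqrt (1 - a i) *\<^sub>R y i)) $ k $ k
    = of_real (if k \<in> I then a i * (cmod (x i $ k))\<^sup>2 else (1 - a i) * (cmod (y i $ k))\<^sup>2)"
    if "i \<in> I" for i
    using a[OF that] adapted_frames_support[OF fr that, of k]
    by (auto simp: outer_def scaleR_conv_of_real[of _ "_ :: complex"] sq simp del: of_real_mult)
  then show ?thesis by (simp add: mixed_projection_def)
qed

lemma two_level_projection_decomposition:
  assumes p: "p \<in> two_level_projections I c" and card: "card I = card (- I)"
  obtains x y a where "adapted_frames I x y" "\<And>i. i \<in> I \<Longrightarrow> 0 \<le> a i \<and> a i \<le> 1"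
    "p = mixed_projection I x y a"
proof -
  have pp: "p \<in> projections" using p by (simp add: two_level_projections_def)
  have "trace p = of_real (\<Sum>k\<in>UNIV. if k \<in> I then c else 1 - c)"
    using p by (simp add: two_level_projections_def trace_def)
  \<comment> \<open>As \<open>I\<close> and its complement have the same size, the levels c and 1 -
    c balance and the trace does not depend on c.\<close>
  also have "(\<Sum>k\<in>UNIV. if k \<in> I then c else 1 - c) = card I"
    using card by (simp add: sum.If_cases algebra_simps flip: Compl_eq)
  finally have "trace p = of_nat (card I)" by simp
  \<comment> \<open>Diagonalising the compression of \<open>coord_proj I\<close> makes the
    components of the \<open>v i\<close> in the subspace of \<open>I\<close> mutually
    orthogonal.\<close>
  then obtain v where v: "orthonormal_on I v" "p = (\<Sum>i\<in>I. outer (v i) (v i))"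
    "\<And>i j. i \<in> I \<Longrightarrow> j \<in> I \<Longrightarrow> i \<noteq> j \<Longrightarrow> hdot (v i) (coord_proj I *v v j) = 0"
    using projection_diagonalizing_basis[OF _ pp, of I "coord_proj I"] by auto
  define f g where "f i = coord_proj I *v v i" and "g i = coord_proj (- I) *v v i" for i
  have fg: "v i = f i + g i" for i
    by (simp add: f_def g_def coord_proj_add_compl flip: matrix_vector_mult_add_rdistrib)
  have hdot_coord: "hdot (coord_proj J *v u) (coord_proj J *v w) = hdot u (coord_proj J *v w)" for J u w
    using hdot_mult_right[of u "coord_proj J" "coord_proj J *v w"] by (simp add: coord_proj_idem)
  have hf: "hdot (f i) (f j) = hdot (v i) (coord_proj I *v v j)" for i j
    by (simp add: f_def hdot_coord)
  \<comment> \<open>Orthogonality of the \<open>v i\<close> and of the \<open>f i\<close> thus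
    passes to the complementary components \<open>g i\<close>.\<close>
  have hg: "hdot (g i) (g j) = hdot (v i) (v j) - hdot (f i) (f j)" for i j
    by (metis add_diff_cancel_left' f_def fg g_def hdot_add_right hdot_coord)
  obtain x where x: "orthonormal_on I x" "coord_proj I = (\<Sum>i\<in>I. outer (x i) (x i))"
    "\<And>i. i \<in> I \<Longrightarrow> f i = norm (f i) *\<^sub>R x i"
  proof (rule extend_orthogonal_to_basis[OF _ coord_proj_projection trace_coord_proj, of I f])
    show "coord_proj I *v f i = f i" for i by (simp add: f_def coord_proj_idem)
  qed (use v(3) in \<open>auto simp: hf\<close>)
  have "trace (coord_proj (- I)) = of_nat (card I)"
    by (simp add: card trace_coord_proj)
  moreover have "hdot (g i) (g j) = 0" if "i \<in> I" "j \<in> I" "i \<noteq> j" for i j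
    using v(1,3) that by (simp add: hg hf orthonormal_on_def)
  ultimately obtain y where y: "orthonormal_on I y" "coord_proj (- I) = (\<Sum>i\<in>I. outer (y i) (y i))"
    "\<And>i. i \<in> I \<Longrightarrow> g i = norm (g i) *\<^sub>R y i"
  proof (rule_tac extend_orthogonal_to_basis[OF _ coord_proj_projection, of I "- I" g])
    show "coord_proj (- I) *v g i = g i" for i by (simp add: g_def coord_proj_idem)
  qed auto
  \<comment> \<open>Since \<open>v i\<close> is a unit vector, \<open>a i\<close> and
    \<open>1 - a i\<close> are the squared norms of its two components, and their square roots are
    the coefficients along \<open>x i\<close> and \<open>y i\<close>.\<close>
  define a where "a i = (norm (f i))\<^sup>2" for i
  have ag: "1 - a i = (norm (g i))\<^sup>2" if "i \<in> I" for i
  proof -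
    have "complex_of_real ((norm (g i))\<^sup>2) = complex_of_real (1 - a i)"
      using hg[of i i] v(1) that
        by (simp add: hdot_self[of "f i"] hdot_self[of "g i"] orthonormal_on_def a_def)
    then show ?thesis by (simp only: of_real_eq_iff)
  qed
  have "sqrt (a i) *\<^sub>R x i + sqrt (1 - a i) *\<^sub>R y i = v i" if "i \<in> I" for i
    using ag[OF that] x(3)[OF that] y(3)[OF that] fg[of i] by (simp add: a_def)
  then have "p = mixed_projection I x y a"
    by (simp add: mixed_projection_def v(2))
  moreover have "0 \<le> a i \<and> a i \<le> 1" if "i \<in> I" for i
    using ag[OF that] by (simp add: a_def) (metis diff_ge_0_iff_ge zero_le_power2)
  moreover have "adapted_frames I x y"
    using x y by (simp add: adapted_frames_def)
  ultimately show ?thesis using that by blast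
qed

section \<open>Deformation to constant weights\<close>

lemma continuous_on_outer [continuous_intros]:
  "continuous_on S f \<Longrightarrow> continuous_on S g \<Longrightarrow> continuous_on S (\<lambda>t. outer (f t) (g t))"
  unfolding outer_def by (intro continuous_intros)

lemma path_component_constant_weight:
  assumes fr: "adapted_frames I x y" and a: "\<And>i. i \<in> I \<Longrightarrow> 0 \<le> a i \<and> a i \<le> 1"
    and c: "0 \<le> c" "c \<le> 1" and p: "mixed_projection I x y a \<in> two_level_projections I c"
  shows "path_component (two_level_projections I c)
    (mixed_projection I x y a) (mixed_projection I x y (\<lambda>_. c))"
proof -
  define b where "b t i = (1 - t) * a i + t * c" for t i
  define g where "g t = mixed_projection I x y (b t)" for t
  have "path g"
    \<comment> \<open>Only continuity of \<open>sqrt\<close> enters, so weights that reach 0 or 1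
      are harmless.\<close>
    unfolding path_def g_def mixed_projection_def b_def
    by (intro continuous_intros)
  moreover have "g t \<in> two_level_projections I c" if t: "t \<in> {0..1}" for t
  proof -
    have b: "0 \<le> b t i \<and> b t i \<le> 1" if "i \<in> I" for i
      using convex_bound_le[of "a i" 1 c "1 - t" t] a[OF that] c t by (auto simp: b_def)
    have "g t $ k $ k = of_real (if k \<in> I then c else 1 - c)" for k
    proof (cases "k \<in> I")
      case True
      then have 1: "(\<Sum>i\<in>I. (cmod (x i $ k))\<^sup>2) = 1"
        using sum_outer_diag fr by (auto simp: adapted_frames_def)
      \<comment> \<open>The diagonal condition on the initial projection; with the Parseval identity
        it fixes the value at both ends of an affine function of t.\<close>
      have "complex_of_real (\<Sum>i\<in>I. a i * (cmod (x i $ k))\<^sup>2) = of_real c"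
        using p a mixed_projection_diag[OF fr, of a, where k=k] True by (simp add: two_level_projections_def)
      then have 2: "(\<Sum>i\<in>I. a i * (cmod (x i $ k))\<^sup>2) = c" by (simp only: of_real_eq_iff)
      have "(\<Sum>i\<in>I. b t i * (cmod (x i $ k))\<^sup>2)
          = (1 - t) * (\<Sum>i\<in>I. a i * (cmod (x i $ k))\<^sup>2) + t * c * (\<Sum>i\<in>I. (cmod (x i $ k))\<^sup>2)"
        by (simp add: b_def sum_distrib_left distrib_right sum.distrib mult.assoc)
      also have "\<dots> = c" by (simp add: 1 2 algebra_simps)
      finally show ?thesis
        using mixed_projection_diag[OF fr, of "b t", where k=k] b True
        by (simp add: g_def del: of_real_sum of_real_mult of_real_power)
    next
      case False
      then have 1: "(\<Sum>i\<in>I. (cmod (y i $ k))\<^sup>2) = 1"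
        using sum_outer_diag[where J="- I" and x=y and k=k] fr by (auto simp: adapted_frames_def)
      have "complex_of_real (\<Sum>i\<in>I. (1 - a i) * (cmod (y i $ k))\<^sup>2) = of_real (1 - c)"
        using p a mixed_projection_diag[OF fr, of a, where k=k] False by (simp add: two_level_projections_def)
      then have 2: "(\<Sum>i\<in>I. (1 - a i) * (cmod (y i $ k))\<^sup>2) = 1 - c" by (simp only: of_real_eq_iff)
      \<comment> \<open>The complementary weights move along a segment as well, from
        \<open>1 - a i\<close> to \<open>1 - c\<close>.\<close>
      have "1 - b t i = (1 - t) * (1 - a i) + t * (1 - c)" for i
        by (simp add: b_def algebra_simps)
      then have "(\<Sum>i\<in>I. (1 - b t i) * (cmod (y i $ k))\<^sup>2)
          = (1 - t) * (\<Sum>i\<in>I. (1 - a i) * (cmod (y i $ k))\<^sup>2)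
            + t * (1 - c) * (\<Sum>i\<in>I. (cmod (y i $ k))\<^sup>2)"
        by (simp add: sum_distrib_left distrib_right sum.distrib mult.assoc)
      also have "\<dots> = 1 - c" by (simp only: 1 2) (simp add: algebra_simps)
      finally show ?thesis
        using mixed_projection_diag[OF fr, of "b t", where k=k] b False
        by (simp add: g_def del: of_real_sum of_real_mult of_real_power)
    qed
    then show ?thesis
      using mixed_projection_projection[OF fr, of "b t"] b by (simp add: two_level_projections_def g_def)
  qed
  ultimately have "path_component (two_level_projections I c) (g 0) (g 1)"
    unfolding path_component_def by (intro exI[of _ g]) (auto simp: path_image_def pathstart_def pathfinish_def)
  then show ?thesis by (simp add: g_def b_def[abs_def])
qed

text \<open>A constant weight factors out of the diagonal sums, and Parseval's identity evaluates
  the rest to 1, whatever the frames are.\<close>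

lemma constant_weight_two_level:
  assumes fr: "adapted_frames I x y" and c: "0 \<le> c" "c \<le> 1"
  shows "mixed_projection I x y (\<lambda>_. c) \<in> two_level_projections I c"
proof -
  have "(\<Sum>i\<in>I. (cmod (x i $ k))\<^sup>2) = 1" if "k \<in> I" for k
    using sum_outer_diag fr that by (auto simp: adapted_frames_def)
  moreover have "(\<Sum>i\<in>I. (cmod (y i $ k))\<^sup>2) = 1" if "k \<notin> I" for k
    using sum_outer_diag[where J="- I" and x=y and k=k] fr that by (auto simp: adapted_frames_def)
  ultimately show ?thesis
    using mixed_projection_projection[OF fr, of "\<lambda>_. c"] mixed_projection_diag[OF fr, of "\<lambda>_. c"] c
    by (simp add: two_level_projections_def flip: sum_distrib_left)
qed

section \<open>Frames as columns of block-diagonal unitaries\<close>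

text \<open>The unitaries commuting with \<open>coord_proj I\<close>, written entrywise; for square
  matrices the one-sided identity is already unitarity.\<close>

definition block_unitaries :: "'m set \<Rightarrow> (complex^'m^'m) set" where
  "block_unitaries I = {W. W ** conj_transpose W = mat 1 \<and>
     (\<forall>k j. (k \<in> I) \<noteq> (j \<in> I) \<longrightarrow> W $ k $ j = 0)}"

lemma hdot_column: "hdot (column i A) (column j A) = (conj_transpose A ** A) $ i $ j"
  by (simp add: hdot_def column_def conj_transpose_def matrix_matrix_mult_def)

lemma hdot_column_unitary:
  fixes W :: "complex^'m^'m"
  assumes "W ** conj_transpose W = mat 1"
  shows "hdot (column i W) (column j W) = (if i = j then 1 else 0)"
proof -
  have "conj_transpose W ** W = mat 1" using assms matrix_left_right_inverse by blast
  then show ?thesis by (simp add: hdot_column mat_def)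
qed

text \<open>For row indices in \<open>I\<close> the zero blocks allow the sum to be extended to all
  columns, which gives an entry of \<open>W ** conj_transpose W\<close>; for other rows every
  summand vanishes.\<close>

lemma block_unitary_sum_outer:
  assumes "W \<in> block_unitaries I"
  shows "(\<Sum>j\<in>I. outer (column j W) (column j W)) = coord_proj I"
proof -
  have "(\<Sum>j\<in>I. W $ k $ j * cnj (W $ l $ j)) = (if k = l \<and> k \<in> I then 1 else 0)" for k l
  proof (cases "k \<in> I \<and> l \<in> I")
    case True
    then have "(\<Sum>j\<in>I. W $ k $ j * cnj (W $ l $ j)) = (\<Sum>j\<in>UNIV. W $ k $ j * cnj (W $ l $ j))"
      using assms by (intro sum.mono_neutral_left) (auto simp: block_unitaries_def)
    also have "\<dots> = (W ** conj_transpose W) $ k $ l"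
      by (simp add: matrix_matrix_mult_def conj_transpose_def)
    also have "\<dots> = (if k = l then 1 else 0)"
      using assms by (simp add: block_unitaries_def mat_def)
    finally show ?thesis using True by simp
  next
    case False
    then show ?thesis
      using assms by (auto simp: block_unitaries_def intro!: sum.neutral)
  qed
  then show ?thesis
    by (simp add: vec_eq_iff outer_def column_def coord_proj_def)
qed

lemma block_unitaries_compl: "block_unitaries (- I) = block_unitaries I"
  by (auto simp: block_unitaries_def)

text \<open>The bijection \<open>s\<close> re-indexes the columns outside \<open>I\<close> by
  \<open>I\<close> and so provides the pairing that the frames require.\<close>

lemma block_unitary_adapted:
  assumes W: "W \<in> block_unitaries I" and s: "bij_betw s I (- I)"
  shows "adapted_frames I (\<lambda>i. column i W) (\<lambda>i. column (s i) W)"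
proof -
  have "(\<Sum>i\<in>I. outer (column (s i) W) (column (s i) W)) = (\<Sum>j\<in>-I. outer (column j W) (column j W))"
    using s by (rule sum.reindex_bij_betw)
  moreover have "s i = s j \<longleftrightarrow> i = j" if "i \<in> I" "j \<in> I" for i j
    using s that by (auto simp: bij_betw_def inj_on_def)
  ultimately show ?thesis
    using W block_unitary_sum_outer[of W I] block_unitary_sum_outer[of W "- I"]
    by (auto simp: adapted_frames_def orthonormal_on_def block_unitaries_compl hdot_column_unitary
        block_unitaries_def)
qed

text \<open>With the \<open>x i\<close> as columns in \<open>I\<close> and the \<open>y i\<close> as
  columns \<open>s i\<close>, the product of \<open>W\<close> with its adjoint is the sum of two
  complementary coordinate projections. Hence the block unitaries reach all adapted frames.\<close>

lemma adapted_frames_block_unitary: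
  assumes fr: "adapted_frames I x y" and s: "bij_betw s I (- I)"
  obtains W where "W \<in> block_unitaries I"
    "\<And>i. i \<in> I \<Longrightarrow> column i W = x i" "\<And>i. i \<in> I \<Longrightarrow> column (s i) W = y i"
proof -
  define w where "w j = (if j \<in> I then x j else y (inv_into I s j))" for j
  define W where "W = (\<chi> k j. w j $ k)"
  have col: "column j W = w j" for j by (simp add: W_def column_def)
  have "s i \<notin> I" "inv_into I s (s i) = i" if "i \<in> I" for i
    using s that by (auto simp: bij_betw_def)
  then have ws: "w (s i) = y i" if "i \<in> I" for i using that by (simp add: w_def)
  have "W ** conj_transpose W = (\<Sum>j\<in>UNIV. outer (w j) (w j))"
    by (simp add: W_def matrix_matrix_mult_def conj_transpose_def outer_def vec_eq_iff)
  also have "\<dots> = (\<Sum>j\<in>I. outer (w j) (w j)) + (\<Sum>j\<in>-I. outer (w j) (w j))"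
    by (subst sum.subset_diff[of I UNIV]) (auto simp: Compl_eq_Diff_UNIV add.commute)
  also have "(\<Sum>j\<in>-I. outer (w j) (w j)) = (\<Sum>i\<in>I. outer (w (s i)) (w (s i)))"
    by (rule sum.reindex_bij_betw[OF s, symmetric])
  also have "\<dots> = (\<Sum>i\<in>I. outer (y i) (y i))" by (simp add: ws)
  also have "(\<Sum>j\<in>I. outer (w j) (w j)) = (\<Sum>j\<in>I. outer (x j) (x j))" by (simp add: w_def)
  finally have "W ** conj_transpose W = mat 1"
    using fr by (simp add: adapted_frames_def coord_proj_add_compl)
  moreover have "W $ k $ j = 0" if "(k \<in> I) \<noteq> (j \<in> I)" for k j
  proof (cases "j \<in> I")
    case False
    then have "inv_into I s j \<in> I" using s by (auto simp: bij_betw_def intro!: inv_into_into)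
    then show ?thesis
      using False that adapted_frames_support[OF fr] by (simp add: W_def w_def)
  qed (use that adapted_frames_support[OF fr] in \<open>simp add: W_def w_def\<close>)
  ultimately have "W \<in> block_unitaries I" by (simp add: block_unitaries_def)
  then show ?thesis using that col ws by (simp add: w_def)
qed

section \<open>Complex reflections and connectedness of the block unitaries\<close>

text \<open>For v \<noteq> 0 this fixes the orthogonal complement of v and multiplies v by z; z = -1
  is the Householder reflection and z = 1 the identity.\<close>

definition complex_reflection :: "complex^'m \<Rightarrow> complex \<Rightarrow> complex^'m^'m" where
  "complex_reflection v z = mat 1 + outer (((z - 1) / hdot v v) *s v) v"

lemma complex_reflection_1 [simp]: "complex_reflection v 1 = mat 1"
  by (simp add: complex_reflection_def outer_def vec_eq_iff)

lemma complex_reflection_mult_vec: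
  "complex_reflection v z *v u = u + ((z - 1) / hdot v v * hdot v u) *s v"
  by (simp add: complex_reflection_def matrix_vector_mult_add_rdistrib outer_mult_vec
      vec_eq_iff algebra_simps)

lemma complex_reflection_unitary:
  assumes "v \<noteq> 0" "cmod z = 1"
  shows "complex_reflection v z ** conj_transpose (complex_reflection v z) = mat 1"
proof -
  define h where "h = hdot v v"
  have h: "h \<noteq> 0" "cnj h = h" using assms by (simp_all add: h_def hdot_self)
  define k where "k = (z - 1) / h"
  have "z * cnj z = 1" using assms(2) by (simp flip: complex_norm_square)
  \<comment> \<open>The left side is (|z|^2 - 1)/h; this scalar identity is unitarity of the
    reflection, and below it is multiplied by the entries of \<open>outer v v\<close>.\<close>
  then have "k + cnj k + h * k * cnj k = 0"
    using h by (simp add: k_def field_simps)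
  then have k: "u * (k + cnj k + h * k * cnj k) = 0" for u by simp
  have "conj_transpose (complex_reflection v z) = mat 1 + outer v (k *s v)"
    by (simp add: complex_reflection_def conj_transpose_def outer_def mat_def vec_eq_iff k_def h_def)
  then have "complex_reflection v z ** conj_transpose (complex_reflection v z)
      = mat 1 + (outer v (k *s v) + (outer (k *s v) v + outer (h *s (k *s v)) (k *s v)))"
    by (simp add: complex_reflection_def matrix_mult_add_left matrix_add_ldistrib outer_mult_outer
        h_def k_def)
  also have "outer v (k *s v) + (outer (k *s v) v + outer (h *s (k *s v)) (k *s v)) = 0"
    (is "?L = 0")
  proof -
    have "?L $ i $ l = 0" for i l
      using k[of "v $ i * cnj (v $ l)"] h(2) by (simp add: outer_def algebra_simps)
    then show ?thesis by (simp add: vec_eq_iff)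
  qed
  finally show ?thesis by simp
qed

text \<open>A Householder reflection along x - y takes x to y only when \<open>hdot y x\<close> is
  real; a free eigenvalue on the unit circle absorbs the phase in the general case.\<close>

lemma complex_reflection_maps:
  assumes "hdot x x = 1" "hdot y y = 1" "x \<noteq> y"
  obtains z where "cmod z = 1" "complex_reflection (x - y) z *v x = y"
proof -
  define u where "u = 1 - hdot y x"
  have h: "hdot (x - y) (x - y) = u + cnj u"
    using assms by (simp add: u_def hdot_diff_left hdot_diff_right cnj_hdot)
  have u: "u \<noteq> 0"
  proof
    assume "u = 0"
    with h have "hdot (x - y) (x - y) = 0" by simp
    then show False using assms(3) by (simp add: hdot_self)
  qed
  have uu: "u + cnj u \<noteq> 0" using h assms(3) by (auto simp: hdot_self)
  \<comment> \<open>The solution of (z - 1) u / (u + cnj u) = -1, the condition that the reflection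
    subtracts exactly x - y from x. It has modulus 1 because u and cnj u have equal modulus.\<close>
  define z where "z = - cnj u / u"
  have "(z - 1) / (u + cnj u) * u = -1"
  proof -
    have "z - 1 = - (u + cnj u) / u" using u by (simp add: z_def field_simps)
    then show ?thesis using u uu by (simp add: field_simps del: minus_add_distrib)
  qed
  moreover have "hdot (x - y) x = u" using assms by (simp add: u_def hdot_diff_left)
  ultimately have "complex_reflection (x - y) z *v x = x + (-1) *s (x - y)"
    by (simp only: complex_reflection_mult_vec h)
  moreover have "cmod z = 1" using u by (simp add: z_def norm_divide)
  ultimately show ?thesis using that by (simp add: vec_eq_iff)
qed

lemma continuous_on_complex_reflection_mult:
  fixes W :: "complex^'m^'m"
  shows "continuous_on S (\<lambda>z. complex_reflection v z ** W)"
proof -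
  have "complex_reflection v z ** W
      = W + outer (((z - 1) / hdot v v) *s v) (conj_transpose W *v v)" for z
    by (simp add: complex_reflection_def matrix_mult_add_left outer_mult)
  then show ?thesis
    unfolding vector_scalar_mult_def divide_inverse by (simp, intro continuous_intros)
qed

text \<open>The index \<open>j\<close> only selects a block: a vector supported in one block has a
  block-diagonal reflection, and block-diagonal unitaries are closed under products.\<close>

lemma reflect_block_unitary:
  assumes W: "W \<in> block_unitaries I" and "v \<noteq> 0" "cmod z = 1"
    and supp: "\<And>k. (k \<in> I) \<noteq> (j \<in> I) \<Longrightarrow> v $ k = 0"
  shows "complex_reflection v z ** W \<in> block_unitaries I"
proof -
  have "(complex_reflection v z ** W) ** conj_transpose (complex_reflection v z ** W)
     = complex_reflection v z ** (W ** conj_transpose W) ** conj_transpose (complex_reflection v z)"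
    by (simp add: conj_transpose_mult matrix_mul_assoc)
  also have "\<dots> = mat 1"
    using W complex_reflection_unitary[OF assms(2,3)] by (simp add: block_unitaries_def)
  finally have *: "(complex_reflection v z ** W) ** conj_transpose (complex_reflection v z ** W) = mat 1" .
  have "complex_reflection v z $ k $ i * W $ i $ l = 0" if "(k \<in> I) \<noteq> (l \<in> I)" for k i l
  proof (cases "(k \<in> I) = (i \<in> I)")
    case True
    then show ?thesis using that W by (auto simp: block_unitaries_def)
  next
    case False
    then have "k \<noteq> i" "v $ k = 0 \<or> v $ i = 0" using supp[of k] supp[of i] by auto
    then show ?thesis by (auto simp: complex_reflection_def outer_def mat_def)
  qed
  then have "(complex_reflection v z ** W) $ k $ l = 0" if "(k \<in> I) \<noteq> (l \<in> I)" for k l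
    unfolding matrix_matrix_mult_def vec_lambda_beta using that by (intro sum.neutral ballI)
  with * show ?thesis by (simp add: block_unitaries_def)
qed

text \<open>A complex reflection moves one more column to its standard basis vector and fixes those
  already in place; letting its eigenvalue run along the unit circle gives a path.\<close>

lemma path_component_block_unitaries:
  assumes "W \<in> block_unitaries I"
  shows "path_component (block_unitaries I) W (mat 1)"
  using assms
\<comment> \<open>The induction measure counts the columns that are not yet standard basis
  vectors.\<close>
proof (induction "card {j. column j W \<noteq> axis j 1}" arbitrary: W rule: less_induct)
  case less
  show ?case
  proof (cases "\<forall>j. column j W = axis j 1")
    case True
    then have "W = mat 1"
      by (simp add: vec_eq_iff column_def axis_def mat_def)
    then show ?thesis using less.prems path_component_refl by blast
  next
    case False
    then obtain j where j: "column j W \<noteq> axis j 1" by blast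
    define v where "v = column j W - axis j 1"
    have "v \<noteq> 0" using j by (simp add: v_def)
    have WW: "W ** conj_transpose W = mat 1" using less.prems by (simp add: block_unitaries_def)
    have hax: "hdot (axis i 1) u = u $ i" for i and u :: "complex^'a"
      by (simp add: hdot_def axis_def if_distrib[of cnj] if_distrib[of "\<lambda>x. x * _"] cong: if_cong)
    obtain z where z: "cmod z = 1" "complex_reflection v z *v column j W = axis j 1"
      using complex_reflection_maps[OF _ _ j] hdot_column_unitary[OF WW, of j j]
      by (auto simp: v_def hax)
    \<comment> \<open>Column \<open>j\<close> of \<open>W\<close> and the basis vector
      \<open>axis j 1\<close> both live in the block of \<open>j\<close>, hence so does their
      difference.\<close>
    have supp: "v $ k = 0" if "(k \<in> I) \<noteq> (j \<in> I)" for k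
      using that less.prems by (auto simp: v_def block_unitaries_def column_def axis_def)
    let ?R = "\<lambda>z. complex_reflection v z ** W"
    have "path_connected (?R ` sphere 0 1)"
      by (intro path_connected_continuous_image continuous_on_complex_reflection_mult
          path_connected_sphere) simp
    moreover have sub: "?R ` sphere 0 1 \<subseteq> block_unitaries I"
      using reflect_block_unitary[OF less.prems \<open>v \<noteq> 0\<close> _ supp] by auto
    \<comment> \<open>The parameter 1 gives back \<open>W\<close>, so the image of the unit circle
      joins \<open>W\<close> to the matrix with column \<open>j\<close> corrected.\<close>
    moreover have "W \<in> ?R ` sphere 0 1"
      by (rule image_eqI[of _ _ 1]) simp_all
    moreover have "?R z \<in> ?R ` sphere 0 1" using z(1) by simp
    ultimately have 1: "path_component (block_unitaries I) W (?R z)"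
      by (metis path_component_of_subset path_connected_component)
    have col: "column i (?R z) = complex_reflection v z *v column i W" for i
      by (simp add: column_def matrix_matrix_mult_def matrix_vector_mult_def)
    \<comment> \<open>A column already in place is orthogonal to column \<open>j\<close> and to
      \<open>axis j 1\<close>, hence to \<open>v\<close>, and the reflection fixes it.\<close>
    have "column i (?R z) = axis i 1" if "column i W = axis i 1" for i
    proof -
      have "i \<noteq> j" using that j by auto
      then have "hdot v (axis i 1) = 0"
        using hdot_column_unitary[OF WW, of j i] that
        by (simp add: v_def hdot_diff_left hax) (simp add: axis_def)
      then show ?thesis by (simp add: col that complex_reflection_mult_vec)
    qed
    then have "{i. column i (?R z) \<noteq> axis i 1} \<subset> {i. column i W \<noteq> axis i 1}"
      using j z(2) col by auto
    then have "card {i. column i (?R z) \<noteq> axis i 1} < card {i. column i W \<noteq> axis i 1}"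
      by (simp add: psubset_card_mono)
    then have "path_component (block_unitaries I) (?R z) (mat 1)"
      using sub z(1) by (intro less.hyps) auto
    with 1 show ?thesis by (rule path_component_trans)
  qed
qed

section \<open>Connectedness of the two-level projections\<close>

theorem path_connected_two_level_projections:
  fixes I :: "'m::finite set"
  assumes c: "0 \<le> c" "c \<le> 1" and card: "card I = card (- I)"
  shows "path_connected (two_level_projections I c)"
proof -
  obtain s where s: "bij_betw s I (- I)"
    using card finite_same_card_bij by (metis finite)
  \<comment> \<open>\<open>F\<close> parametrises the constant-weight projections by block
    unitaries, so they form a connected set to which every other point will be joined.\<close>
  define F where
    "F W = mixed_projection I (\<lambda>i. column i W) (\<lambda>i. column (s i) W) (\<lambda>_. c)" for W :: "complex^'m^'m"
  have "path_connected (block_unitaries I)"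
    unfolding path_connected_component
    by (meson path_component_block_unitaries path_component_sym path_component_trans)
  moreover have "continuous_on (block_unitaries I) F"
    unfolding F_def mixed_projection_def column_def by (intro continuous_intros)
  ultimately have pc: "path_connected (F ` block_unitaries I)"
    by (rule path_connected_continuous_image[rotated])
  have sub: "F ` block_unitaries I \<subseteq> two_level_projections I c"
    using constant_weight_two_level[OF block_unitary_adapted[OF _ s] c] by (auto simp: F_def)
  have to_F: "\<exists>W\<in>block_unitaries I. path_component (two_level_projections I c) p (F W)"
    if p: "p \<in> two_level_projections I c" for p
  proof -
    obtain x y a where xy: "adapted_frames I x y" "\<And>i. i \<in> I \<Longrightarrow> 0 \<le> a i \<and> a i \<le> 1"
      "p = mixed_projection I x y a"
      using two_level_projection_decomposition[OF p card] by metis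
    obtain W where W: "W \<in> block_unitaries I"
      "\<And>i. i \<in> I \<Longrightarrow> column i W = x i" "\<And>i. i \<in> I \<Longrightarrow> column (s i) W = y i"
      using adapted_frames_block_unitary[OF xy(1) s] by metis
    have "F W = mixed_projection I x y (\<lambda>_. c)"
      using W(2,3) by (simp add: F_def mixed_projection_def)
    then have "path_component (two_level_projections I c) p (F W)"
      using path_component_constant_weight[OF xy(1) _ c, of a] xy(2) p xy(3) by simp
    then show ?thesis using W(1) by blast
  qed
  show ?thesis
    unfolding path_connected_component
  proof (intro ballI)
    fix p q assume "p \<in> two_level_projections I c" "q \<in> two_level_projections I c"
    then obtain V W where VW: "V \<in> block_unitaries I" "W \<in> block_unitaries I"
      "path_component (two_level_projections I c) p (F V)"
      "path_component (two_level_projections I c) q (F W)"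
      using to_F by meson
    have "path_component (two_level_projections I c) (F V) (F W)"
      using pc sub VW(1,2) by (meson imageI path_component_of_subset path_connected_component)
    then show "path_component (two_level_projections I c) p q"
      using VW(3,4) by (meson path_component_sym path_component_trans)
  qed
qed

theorem theorem4p1:
  fixes n :: nat and e d :: "complex^'m^'m" and \<theta> :: real
  assumes "n \<ge> 1"
    and "CARD('m) = 2 * n"
    and "e \<in> diagonal_matrices"
    and "e \<in> projections"
    and "rank e = n"
    and "\<theta> \<in> {0..pi/2}"
    and "d = (cos \<theta>)\<^sup>2 *\<^sub>R e + (sin \<theta>)\<^sup>2 *\<^sub>R perp e"
  shows "path_connected {p \<in> projections. diag_part p = d}"
proof -
  define I where "I = {i. e $ i $ i = 1}"
  have e: "e = coord_proj I"
    using diagonal_projection_eq_coord_proj assms(3,4) by (simp add: I_def)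
  have "card I = n" using assms(5) by (simp add: e rank_coord_proj)
  \<comment> \<open>The rank is half of the 2n coordinates, so the two coordinate subspaces have
    equal dimension.\<close>
  then have card: "card I = card (- I)"
    using assms(2) by (simp add: Compl_eq_Diff_UNIV card_Diff_subset)
  \<comment> \<open>Both sides are diagonal, so only diagonal entries matter, and sin^2 = 1 - cos^2
    puts \<open>d\<close> in two-level form with c = cos^2 \<theta>.\<close>
  have "diag_part p = d \<longleftrightarrow> (\<forall>k. p $ k $ k = of_real (if k \<in> I then (cos \<theta>)\<^sup>2 else 1 - (cos \<theta>)\<^sup>2))"
    for p :: "complex^'m^'m"
    by (auto simp: diag_part_def vec_eq_iff assms(7) e perp_def coord_proj_def mat_def
        sin_squared_eq scaleR_conv_of_real[of _ "_ :: complex"])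
  then have "{p \<in> projections. diag_part p = d} = two_level_projections I ((cos \<theta>)\<^sup>2)"
    by (auto simp: two_level_projections_def)
  then show ?thesis
    using path_connected_two_level_projections[OF _ _ card, of "(cos \<theta>)\<^sup>2"]
    by (simp add: abs_square_le_1)
qed

end
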